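(* Let $G=(V,E)$ be a finite connected multigraph (loops and parallel edges permitted) whose edge weights $(w(g))_{g\in E}$ are independent and identically distributed with an atomless law on $\mathbb{R}$, and let $T=\mathrm{MST}(G)$ be the almost surely unique minimum spanning tree. Then for every two distinct edges $e\neq f$ of $G$, $$\mathbf{P}(e\in T,\ f\in T)\;\le\;8\,\mathbf{P}(e\in T)\,\mathbf{P}(f\in T).$$
   Context: Since the common law is atomless, almost surely all edge weights are distinct, so the spanning tree of minimal total weight is almost surely unique (it is the output of Kruskal's algorithm and depends on the weights only through their relative order). A loop is never in the minimum spanning tree. Two distinct edges of a multigraph may have the same endpoints. *)

theory Defs
  imports "HOL-Probability.Probability" "HOL-Library.Uprod"
begin

text \<open>
  Edges are abstract objects, so distinct edges may have the same unordered pair of ends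
  (parallel edges), and an edge with ends \<open>Upair v v\<close> is a loop.
\<close>

record ('v, 'e) multigraph =
  verts :: "'v set"
  edges :: "'e set"
  ends  :: "'e \<Rightarrow> 'v uprod"

locale finite_multigraph =
  fixes G :: "('v, 'e) multigraph"
  assumes finite_verts: "finite (verts G)"
    and finite_edges: "finite (edges G)"
    and ends_in_verts: "g \<in> edges G \<Longrightarrow> set_uprod (ends G g) \<subseteq> verts G"

definition adj_rel :: "('v, 'e) multigraph \<Rightarrow> ('v \<times> 'v) set" where
  "adj_rel G = {(u, v). \<exists>g\<in>edges G. ends G g = Upair u v}"

definition connected_graph :: "('v, 'e) multigraph \<Rightarrow> bool" where
  "connected_graph G \<longleftrightarrow> verts G \<noteq> {} \<and> (\<forall>u\<in>verts G. \<forall>v\<in>verts G. (u, v) \<in> (adj_rel G)\<^sup>*)"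

text \<open>
  A cycle visits the distinct vertices \<open>vs\<close> in cyclic order along the distinct edges \<open>es\<close>.
  Length 1 is a loop and length 2 is a pair of parallel edges.
\<close>

definition is_cycle :: "('v, 'e) multigraph \<Rightarrow> 'v list \<Rightarrow> 'e list \<Rightarrow> bool" where
  "is_cycle G vs es \<longleftrightarrow>
     es \<noteq> [] \<and> length vs = length es \<and> distinct vs \<and> distinct es \<and> set es \<subseteq> edges G \<and>
     (\<forall>i<length es. ends G (es ! i) = Upair (vs ! i) (vs ! (Suc i mod length vs)))"

definition is_tree :: "('v, 'e) multigraph \<Rightarrow> bool" where
  "is_tree G \<longleftrightarrow> connected_graph G \<and> (\<nexists>vs es. is_cycle G vs es)"

text \<open>A spanning tree is identified with its edge set, the vertex set being all of \<open>verts G\<close>.\<close>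

definition spanning_tree :: "('v, 'e) multigraph \<Rightarrow> 'e set \<Rightarrow> bool" where
  "spanning_tree G T \<longleftrightarrow> T \<subseteq> edges G \<and> is_tree (G\<lparr>edges := T\<rparr>)"

definition is_mst :: "('v, 'e) multigraph \<Rightarrow> ('e \<Rightarrow> real) \<Rightarrow> 'e set \<Rightarrow> bool" where
  "is_mst G w T \<longleftrightarrow>
     spanning_tree G T \<and> (\<forall>T'. spanning_tree G T' \<longrightarrow> (\<Sum>g\<in>T. w g) \<le> (\<Sum>g\<in>T'. w g))"

text \<open>
  Unspecified when the minimizer is not unique. For a connected \<open>G\<close> this can only happen if two
  edge weights coincide, which has probability 0 for independent weights with an atomless law.
  The value depends on \<open>w\<close> only through the set of minimizers, one of finitely many subsets of
  \<open>Pow (edges G)\<close>, so it is a measurable function of the weights regardless.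
\<close>

definition MST :: "('v, 'e) multigraph \<Rightarrow> ('e \<Rightarrow> real) \<Rightarrow> 'e set" where
  "MST G w = (THE T. is_mst G w T)"

end

theory Submission
  imports Defs
begin

text \<open>
  Say that a set of edges separates \<open>g\<close> if it does not connect the ends of \<open>g\<close>. For distinct weights
  \<open>g\<close> lies in the minimum spanning tree iff the edges lighter than \<open>g\<close> separate it. Suppose that \<open>w e < w f\<close> and let \<open>L\<close>
  be the set of edges lighter than \<open>e\<close>. Given \<open>L\<close>, the relative order of the remaining edges
  \<open>R = E - L - {e}\<close> is still uniformly random, and \<open>f\<close> is in the tree iff it is separated by
  \<open>L \<union> {e} \<union> {g \<in> R. w g < w f}\<close>. This set contains every edge lighter than \<open>f\<close>, so that
  the conditional probability is at most \<open>P(f \<in> T)\<close>. Summing over the sets \<open>L\<close> that separate \<open>e\<close>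
  gives \<open>P(e \<in> T, f \<in> T, w e < w f) \<le> P(e \<in> T) P(f \<in> T)\<close>, and by symmetry the theorem holds
  with 2 in place of 8.
\<close>

subsection \<open>Connectivity and spanning trees\<close>

definition conn :: "('v, 'e) multigraph \<Rightarrow> 'e set \<Rightarrow> 'v \<Rightarrow> 'v \<Rightarrow> bool" where
  "conn G S u v \<longleftrightarrow> (u, v) \<in> (adj_rel (G\<lparr>edges := S\<rparr>))\<^sup>*"

text \<open>In matroid terms, \<open>g\<close> lies in the span of \<open>S\<close>. A loop is
  joined even by the empty set, by reflexivity of \<open>conn\<close>, and this is what keeps it out
  of every spanning tree.\<close>

definition joins :: "('v, 'e) multigraph \<Rightarrow> 'e set \<Rightarrow> 'e \<Rightarrow> bool" where
  "joins G S g \<longleftrightarrow> (\<exists>u v. ends G g = Upair u v \<and> conn G S u v)"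

lemma conn_refl [simp]: "conn G S u u"
  by (simp add: conn_def)

lemma conn_trans: "conn G S u v \<Longrightarrow> conn G S v x \<Longrightarrow> conn G S u x"
  by (auto simp: conn_def)

lemma conn_edge: "g \<in> S \<Longrightarrow> ends G g = Upair u v \<Longrightarrow> conn G S u v"
  by (auto simp: conn_def adj_rel_def)

lemma conn_sym: "conn G S u v \<Longrightarrow> conn G S v u"
proof -
  have "sym (adj_rel (G\<lparr>edges := S\<rparr>))"
    by (auto simp: sym_def adj_rel_def) (metis Upair_inject)
  then show "conn G S u v \<Longrightarrow> conn G S v u"
    by (auto simp: conn_def dest: sym_rtrancl symD)
qed

lemma conn_induct [consumes 1, case_names refl step]:
  assumes "conn G S u v" and "P u"
    and "\<And>x y g. conn G S u x \<Longrightarrow> P x \<Longrightarrow> g \<in> S \<Longrightarrow> ends G g = Upair x y \<Longrightarrow> P y"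
  shows "P v"
  using assms(1) unfolding conn_def
proof (induction rule: rtrancl_induct)
  case base
  show ?case by fact
next
  case (step y z)
  then show ?case
    using assms(3) by (auto simp: adj_rel_def conn_def)
qed

lemma joins_iff: "ends G g = Upair u v \<Longrightarrow> joins G S g \<longleftrightarrow> conn G S u v"
  by (auto simp: joins_def dest: conn_sym)

lemma joins_self: "g \<in> S \<Longrightarrow> joins G S g"
  by (metis conn_edge joins_def uprod_exhaust)

text \<open>Each edge of the walk is replaced by a walk in \<open>S'\<close> between its ends. This
  is transitivity of span; monotonicity in the edge set is a special case.\<close>

lemma conn_if_joins:
  assumes "conn G S u v" and "\<And>g. g \<in> S \<Longrightarrow> joins G S' g"
  shows "conn G S' u v"
  using assms(1)
proof (induction rule: conn_induct)
  case (step x y g)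
  then show ?case
    using assms(2) by (metis conn_trans joins_iff)
qed simp

lemma joins_if_joins:
  assumes "joins G S g" and "\<And>h. h \<in> S \<Longrightarrow> joins G S' h"
  shows "joins G S' g"
  using assms unfolding joins_def [of G S g] by (metis conn_if_joins joins_iff)

lemma conn_mono: "conn G S u v \<Longrightarrow> S \<subseteq> S' \<Longrightarrow> conn G S' u v"
  by (erule conn_if_joins) (auto intro: joins_self)

lemma joins_mono: "joins G S g \<Longrightarrow> S \<subseteq> S' \<Longrightarrow> joins G S' g"
  by (auto simp: joins_def intro: conn_mono)

text \<open>A walk can be shortened so that it uses \<open>h\<close> at most once; the last two
  alternatives are the two directions of traversal. This is the source of all exchange arguments
  below.\<close>

lemma conn_insertD:
  assumes "conn G (insert h S) x y" and h: "ends G h = Upair a b"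
  shows "conn G S x y \<or> conn G S x a \<and> conn G S b y \<or> conn G S x b \<and> conn G S a y"
  using assms(1)
proof (induction rule: conn_induct)
  case (step y z g)
  show ?case
  proof (cases "g \<in> S")
    case True
    then show ?thesis
      using step by (meson conn_edge conn_trans)
  next
    case False
    then have "y = a \<and> z = b \<or> y = b \<and> z = a"
      using step h by auto
    then show ?thesis
      using step.IH by auto
  qed
qed simp

text \<open>Loop erasure: a new vertex extends the path, and a vertex visited before truncates it at
  that visit. Paths are functions with a length, so that truncation changes only
  \<open>n\<close>.\<close>

lemma conn_simple_path:
  assumes "conn G S u v"
  shows "\<exists>p q n. p 0 = u \<and> p n = v \<and> inj_on p {..n} \<and>
    (\<forall>i<n. q i \<in> S \<and> ends G (q i) = Upair (p i) (p (Suc i)))"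
  using assms
proof (induction rule: conn_induct)
  case refl
  show ?case
    by (rule exI[of _ "\<lambda>_. u"], rule exI, rule exI[of _ 0]) auto
next
  case (step x y g)
  then obtain p q n where pq: "p 0 = u" "p n = x" "inj_on p {..n}"
    "\<And>i. i < n \<Longrightarrow> q i \<in> S \<and> ends G (q i) = Upair (p i) (p (Suc i))"
    by blast
  show ?case
  proof (cases "y \<in> p ` {..n}")
    case True
    then obtain m where m: "m \<le> n" "p m = y"
      by auto
    have "inj_on p {..m}"
      using pq(3) by (rule inj_on_subset) (use m in auto)
    then show ?thesis
      using pq m by (intro exI[of _ p] exI[of _ q] exI[of _ m]) auto
  next
    case False
    let ?p = "p(Suc n := y)"
    have "inj_on ?p {..Suc n}"
      using pq(3) False by (auto simp: inj_on_def atMost_Suc)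
    moreover have "\<forall>i<Suc n. (q(n := g)) i \<in> S \<and> ends G ((q(n := g)) i) = Upair (?p i) (?p (Suc i))"
      using pq(2,4) step.hyps by (auto simp: less_Suc_eq)
    moreover have "?p 0 = u" "?p (Suc n) = y"
      using pq(1) by auto
    ultimately show ?thesis
      by blast
  qed
qed

text \<open>A simple path between the ends of \<open>g\<close> that avoids \<open>g\<close> is
  closed to a cycle by \<open>g\<close>, placed at index \<open>n\<close>. If \<open>g\<close> is a
  loop, the path has length 0.\<close>

lemma cycle_if_joins:
  assumes g: "g \<in> T" and "joins G (T - {g}) g"
  shows "\<exists>vs es. is_cycle (G\<lparr>edges := T\<rparr>) vs es"
proof -
  obtain u v where uv: "ends G g = Upair u v" "conn G (T - {g}) u v"
    using assms by (auto simp: joins_def)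
  then obtain p q n where pq: "p 0 = u" "p n = v" "inj_on p {..n}"
    "\<And>i. i < n \<Longrightarrow> q i \<in> T - {g} \<and> ends G (q i) = Upair (p i) (p (Suc i))"
    using conn_simple_path[OF uv(2)] by blast
  let ?q = "q(n := g)"
  \<comment> \<open>Equal edges have equal ends, so \<open>p i\<close> would reappear at index
    \<open>j\<close> or \<open>Suc j\<close>, both larger than \<open>i\<close> and at most
    \<open>n\<close>.\<close>
  have neq: "q i \<noteq> q j" if "i < j" "j < n" for i j
  proof
    assume "q i = q j"
    then have "p i = p j \<or> p i = p (Suc j)"
      using pq(4)[of i] pq(4)[of j] that by auto
    then show False
      using inj_onD[OF pq(3), of i j] inj_onD[OF pq(3), of i "Suc j"] that by auto
  qed
  have "inj_on q {..<n}"
    by (rule inj_onI) (metis lessThan_iff linorder_neqE_nat neq)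
  moreover have "g \<notin> q ` {..<n}"
    using pq(4) by auto
  ultimately have "inj_on ?q {..<Suc n}"
    by (auto simp: inj_on_def less_Suc_eq)
  moreover have "ends G (?q i) = Upair (p i) (p (Suc i mod Suc n))" if "i < Suc n" for i
    using pq(1,2) pq(4)[of i] that uv(1) by (cases "i = n") auto
  moreover have "?q ` {..<Suc n} \<subseteq> T"
    using pq(4) g by (auto simp: less_Suc_eq)
  ultimately have "is_cycle (G\<lparr>edges := T\<rparr>) (map p [0..<Suc n]) (map ?q [0..<Suc n])"
    using pq(3)
    by (simp add: is_cycle_def distinct_map atLeast0LessThan lessThan_Suc_atMost nth_append
        del: upt_Suc fun_upd_apply)
  then show ?thesis
    by blast
qed

text \<open>The edges of the cycle other than the last form a path from the first vertex to the last
  one, and the last edge \<open>es ! n\<close> has these two vertices as its ends.\<close>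

lemma joins_if_cycle:
  assumes "is_cycle (G\<lparr>edges := T\<rparr>) vs es"
  shows "\<exists>g\<in>T. joins G (T - {g}) g"
proof -
  define n where "n = length es - 1"
  have len: "length es = Suc n" "length vs = Suc n" and d: "distinct es" and sub: "set es \<subseteq> T"
    using assms by (auto simp: is_cycle_def n_def)
  have e: "ends G (es ! i) = Upair (vs ! i) (vs ! (Suc i mod Suc n))" if "i < Suc n" for i
    using assms that by (auto simp: is_cycle_def len)
  have "conn G (T - {es ! n}) (vs ! 0) (vs ! i)" if "i \<le> n" for i
    using that
  proof (induction i)
    case (Suc i)
    have "es ! i \<in> T - {es ! n}"
      using Suc.prems sub d len by (auto simp: nth_eq_iff_index_eq subset_iff)
    moreover have "ends G (es ! i) = Upair (vs ! i) (vs ! Suc i)"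
      using e[of i] Suc.prems by simp
    ultimately show ?case
      using Suc by (meson Suc_leD conn_edge conn_trans)
  qed simp
  then have "conn G (T - {es ! n}) (vs ! 0) (vs ! n)"
    by simp
  then have "joins G (T - {es ! n}) (es ! n)"
    using e[of n] by (auto simp: joins_def intro: conn_sym)
  moreover have "es ! n \<in> T"
    using sub len by auto
  ultimately show ?thesis
    by blast
qed

lemma acyclic_iff_not_joins:
  "(\<nexists>vs es. is_cycle (G\<lparr>edges := T\<rparr>) vs es) \<longleftrightarrow> (\<forall>g\<in>T. \<not> joins G (T - {g}) g)"
  using cycle_if_joins joins_if_cycle by metis

section \<open>Spanning trees and the cut criterion for the minimum spanning tree\<close>

locale connected_multigraph = finite_multigraph G
  for G :: "('v, 'e) multigraph" +
  assumes connected: "connected_graph G"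
begin

text \<open>Spanning trees as the bases of the graphic matroid. Joining every edge of
  \<open>G\<close> suffices for connectedness, because a walk in the connected graph
  \<open>G\<close> can be replaced edge by edge.\<close>

lemma spanning_tree_iff:
  "spanning_tree G T \<longleftrightarrow>
     T \<subseteq> edges G \<and> (\<forall>g\<in>edges G. joins G T g) \<and> (\<forall>g\<in>T. \<not> joins G (T - {g}) g)"
proof -
  have self: "G\<lparr>edges := edges G\<rparr> = G"
    by simp
  have "connected_graph (G\<lparr>edges := T\<rparr>) \<longleftrightarrow> (\<forall>g\<in>edges G. joins G T g)"
  proof
    assume c: "connected_graph (G\<lparr>edges := T\<rparr>)"
    show "\<forall>g\<in>edges G. joins G T g"
    proof
      fix g assume "g \<in> edges G"
      moreover obtain u v where uv: "ends G g = Upair u v"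
        by (cases "ends G g")
      ultimately show "joins G T g"
        using c ends_in_verts[of g]
        by (auto simp: connected_graph_def joins_iff[OF uv] conn_def)
    qed
  next
    assume j: "\<forall>g\<in>edges G. joins G T g"
    have "conn G T u v" if "u \<in> verts G" "v \<in> verts G" for u v
    proof (rule conn_if_joins)
      show "conn G (edges G) u v"
        using connected that by (simp add: connected_graph_def conn_def self)
    qed (use j in auto)
    then show "connected_graph (G\<lparr>edges := T\<rparr>)"
      using connected by (auto simp: connected_graph_def conn_def)
  qed
  then show ?thesis
    unfolding spanning_tree_def is_tree_def acyclic_iff_not_joins by blast
qed

lemma spanning_tree_finite: "spanning_tree G T \<Longrightarrow> finite T"
  using finite_edges finite_subset spanning_tree_def by blast

text \<open>Take an inclusion-minimal set that joins all edges. An edge joined by the others could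
  be deleted without loss, so there is none.\<close>

lemma spanning_tree_exists: "\<exists>T. spanning_tree G T"
proof -
  let ?F = "{S. S \<subseteq> edges G \<and> (\<forall>g\<in>edges G. joins G S g)}"
  have "finite ?F"
    using finite_edges by simp
  moreover have "edges G \<in> ?F"
    by (auto intro: joins_self)
  ultimately obtain T where T: "T \<in> ?F" "\<And>S. S \<in> ?F \<Longrightarrow> S \<subseteq> T \<Longrightarrow> T = S"
    using finite_has_minimal2[of ?F "edges G"] by auto
  have False if g: "g \<in> T" "joins G (T - {g}) g" for g
  proof -
    have "joins G (T - {g}) h" if "h \<in> T" for h
      using that g by (cases "h = g") (auto intro: joins_self)
    then have "T - {g} \<in> ?F"
      using T(1) by (blast intro: joins_if_joins)
    then show False
      using T(2)[of "T - {g}"] g by auto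
  qed
  then show ?thesis
    using T(1) spanning_tree_iff by blast
qed

lemma is_mst_exists: "\<exists>T. is_mst G w T"
proof -
  have "{T. spanning_tree G T} \<subseteq> Pow (edges G)"
    by (auto simp: spanning_tree_def)
  then have "finite {T. spanning_tree G T}"
    using finite_edges by (meson finite_Pow_iff finite_subset)
  then have "finite (sum w ` {T. spanning_tree G T})"
    by simp
  moreover have "sum w ` {T. spanning_tree G T} \<noteq> {}"
    using spanning_tree_exists by auto
  ultimately have "Min (sum w ` {T. spanning_tree G T}) \<in> sum w ` {T. spanning_tree G T}"
    and "\<forall>T'. spanning_tree G T' \<longrightarrow> Min (sum w ` {T. spanning_tree G T}) \<le> sum w T'"
    by (rule Min_in, auto intro!: Min_le)
  then show ?thesis
    by (auto simp: is_mst_def)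
qed

text \<open>Deleting \<open>h\<close> splits the tree in two, and \<open>e\<close> runs between the
  two parts, so adding \<open>e\<close> reconnects them without creating a cycle.\<close>

lemma spanning_tree_exchange:
  assumes T: "spanning_tree G T" and h: "h \<in> T" and e: "e \<in> edges G"
    and sep: "\<not> joins G (T - {h}) e"
  shows "spanning_tree G (insert e (T - {h}))"
proof -
  let ?F = "T - {h}"
  obtain a b where ab: "ends G h = Upair a b"
    by (cases "ends G h")
  obtain u v where uv: "ends G e = Upair u v"
    by (cases "ends G e")
  have eF: "e \<notin> ?F"
    using sep joins_self by metis
  have jT: "\<forall>g\<in>edges G. joins G T g" and fT: "\<forall>g\<in>T. \<not> joins G (T - {g}) g" and sub: "T \<subseteq> edges G"
    using T by (auto simp: spanning_tree_iff)
  have "conn G (insert h ?F) u v"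
    using jT e h by (simp add: joins_iff[OF uv, symmetric] insert_absorb)
  \<comment> \<open>The tree path between the ends of \<open>e\<close> must use \<open>h\<close>, so
    \<open>?F\<close> connects each end of \<open>e\<close> to a different end of \<open>h\<close>.
    With \<open>e\<close> added, this connects \<open>a\<close> to \<open>b\<close>.\<close>
  then have "conn G ?F u a \<and> conn G ?F b v \<or> conn G ?F u b \<and> conn G ?F a v"
    using conn_insertD[OF _ ab] sep by (metis joins_iff[OF uv])
  then have "conn G (insert e ?F) u a \<and> conn G (insert e ?F) b v \<or>
      conn G (insert e ?F) u b \<and> conn G (insert e ?F) a v"
    by (metis conn_mono subset_insertI)
  moreover have "conn G (insert e ?F) u v"
    using uv by (auto intro: conn_edge)
  ultimately have "conn G (insert e ?F) a b"
    by (meson conn_sym conn_trans)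
  then have "joins G (insert e ?F) g" if "g \<in> T" for g
    using that by (cases "g = h") (auto simp: joins_iff[OF ab] intro: joins_self)
  then have "\<forall>g\<in>edges G. joins G (insert e ?F) g"
    using jT by (blast intro: joins_if_joins)
  moreover have "\<not> joins G (insert e ?F - {k}) k" if k: "k \<in> insert e ?F" for k
  proof (cases "k = e")
    case True
    then show ?thesis
      using sep eF by simp
  next
    case False
    then have kF: "k \<in> ?F" and eq: "insert e ?F - {k} = insert e (?F - {k})"
      using k by auto
    obtain x y where xy: "ends G k = Upair x y"
      by (cases "ends G k")
    show ?thesis
    proof
      assume "joins G (insert e ?F - {k}) k"
      then have "conn G (insert e (?F - {k})) x y"
        using eq by (simp add: joins_iff[OF xy])
      moreover have "\<not> conn G (?F - {k}) x y"
        using fT kF joins_mono[of G "?F - {k}" k "T - {k}"]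
        by (auto simp: joins_iff[OF xy, symmetric])
      \<comment> \<open>A path that bypasses \<open>k\<close> must use \<open>e\<close>, as
        \<open>T\<close> is acyclic. Its remaining pieces together with \<open>k\<close> would
        connect the ends of \<open>e\<close> inside \<open>?F\<close>.\<close>
      ultimately have "conn G (?F - {k}) x u \<and> conn G (?F - {k}) v y \<or>
          conn G (?F - {k}) x v \<and> conn G (?F - {k}) u y"
        using conn_insertD[OF _ uv] by metis
      then have "conn G ?F x u \<and> conn G ?F v y \<or> conn G ?F x v \<and> conn G ?F u y"
        by (meson Diff_subset conn_mono)
      moreover have "conn G ?F x y"
        using kF xy by (rule conn_edge)
      ultimately have "conn G ?F u v"
        by (meson conn_sym conn_trans)
      then show False
        using sep by (simp add: joins_iff[OF uv])
    qed
  qed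
  ultimately show ?thesis
    using sub e by (auto simp: spanning_tree_iff)
qed

lemma mst_exchange:
  assumes "is_mst G w T" and h: "h \<in> T" and e: "e \<in> edges G"
    and sep: "\<not> joins G (T - {h}) e"
  shows "w h \<le> w e"
proof -
  have T: "spanning_tree G T"
    using assms(1) by (simp add: is_mst_def)
  have "e \<notin> T - {h}"
    using sep joins_self by metis
  then have "sum w (insert e (T - {h})) = w e + (sum w T - w h)"
    using spanning_tree_finite[OF T] h by (simp add: sum_diff1)
  moreover have "sum w T \<le> sum w (insert e (T - {h}))"
    using assms(1) spanning_tree_exchange[OF T h e sep] by (simp add: is_mst_def)
  ultimately show ?thesis
    by simp
qed

text \<open>Both directions exchange an edge of \<open>T\<close> for a lighter one outside it: a
  tree edge \<open>e\<close> for an edge of \<open>?L\<close>, or a heavier edge on the tree path of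
  \<open>e\<close> for \<open>e\<close> itself.\<close>

lemma mst_iff:
  assumes mst: "is_mst G w T" and inj: "inj_on w (edges G)" and e: "e \<in> edges G"
  shows "e \<in> T \<longleftrightarrow> \<not> joins G {g \<in> edges G. w g < w e} e"
proof
  have T: "spanning_tree G T"
    using mst by (simp add: is_mst_def)
  then have sub: "T \<subseteq> edges G" and jT: "joins G T e" and fT: "\<forall>g\<in>T. \<not> joins G (T - {g}) g"
    using e by (auto simp: spanning_tree_iff)
  let ?L = "{g \<in> edges G. w g < w e}"
  show "\<not> joins G ?L e" if "e \<in> T"
  proof
    assume "joins G ?L e"
    \<comment> \<open>Otherwise the lighter edge \<open>h\<close> could replace \<open>e\<close> in
      \<open>T\<close>.\<close>
    moreover have "joins G (T - {e}) h" if "h \<in> ?L" for h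
      using mst_exchange[OF mst \<open>e \<in> T\<close>, of h] that by force
    ultimately have "joins G (T - {e}) e"
      by (blast intro: joins_if_joins)
    then show False
      using fT \<open>e \<in> T\<close> by blast
  qed
  show "e \<in> T" if nj: "\<not> joins G ?L e"
  proof (rule ccontr)
    assume eT: "e \<notin> T"
    \<comment> \<open>A maximal member \<open>S\<close> of \<open>F\<close> locates a suitable edge
      without naming the tree path: adding any \<open>h\<close> from \<open>T - S\<close> joins
      \<open>e\<close>, so \<open>h\<close> lies on that path, and \<open>h\<close> is outside
      \<open>?L\<close> since \<open>S\<close> contains \<open>T \<inter> ?L\<close>.\<close>
    define F where "F = {S. S \<subseteq> T \<and> T \<inter> ?L \<subseteq> S \<and> \<not> joins G S e}"
    have "finite F"
      using spanning_tree_finite[OF T] by (simp add: F_def)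
    moreover have "T \<inter> ?L \<in> F"
      using nj joins_mono[of G "T \<inter> ?L" e ?L] by (auto simp: F_def)
    ultimately obtain S where SF: "S \<in> F" and max: "\<forall>S'\<in>F. S \<subseteq> S' \<longrightarrow> S = S'"
      by (blast dest: finite_has_maximal2)
    then have S: "S \<subseteq> T" "T \<inter> ?L \<subseteq> S" "\<not> joins G S e"
      by (simp_all add: F_def)
    have "S \<noteq> T"
      using S(3) jT by auto
    then obtain h where h: "h \<in> T" "h \<notin> S"
      using S(1) by blast
    obtain a b where ab: "ends G h = Upair a b"
      by (cases "ends G h")
    obtain u v where uv: "ends G e = Upair u v"
      by (cases "ends G e")
    have "joins G (insert h S) e"
    proof (rule ccontr)
      assume "\<not> joins G (insert h S) e"
      then have "insert h S \<in> F"
        using S h by (auto simp: F_def)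
      then show False
        using max h by blast
    qed
    then have "conn G S u a \<and> conn G S b v \<or> conn G S u b \<and> conn G S a v"
      using conn_insertD[OF _ ab] S(3) by (auto simp: joins_iff[OF uv])
    then have c: "conn G (T - {h}) u a \<and> conn G (T - {h}) b v \<or>
        conn G (T - {h}) u b \<and> conn G (T - {h}) a v"
      using conn_mono[of G S _ _ "T - {h}"] S(1) h by blast
    have "\<not> joins G (T - {h}) e"
    proof
      assume "joins G (T - {h}) e"
      then have "conn G (T - {h}) a b"
        using c by (metis conn_sym conn_trans joins_iff[OF uv])
      then show False
        using fT h by (auto simp: joins_iff[OF ab, symmetric])
    qed
    then have "w h \<le> w e"
      using mst_exchange[OF mst h(1) e] by blast
    moreover have "w h \<noteq> w e"
      using inj h eT e sub by (metis inj_on_def subsetD)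
    ultimately have "h \<in> ?L"
      using h sub by auto
    then show False
      using S(2) h by auto
  qed
qed

text \<open>The criterion of \<open>mst_iff\<close> does not mention the tree, so all minimizers
  coincide and the definite description in \<open>MST\<close> is proper.\<close>

lemma mem_MST_iff:
  assumes inj: "inj_on w (edges G)" and e: "e \<in> edges G"
  shows "e \<in> MST G w \<longleftrightarrow> \<not> joins G {g \<in> edges G. w g < w e} e"
proof -
  obtain T where T: "is_mst G w T"
    using is_mst_exists by blast
  have unique: "T' = T" if "is_mst G w T'" for T'
  proof -
    have "T' \<subseteq> edges G" "T \<subseteq> edges G"
      using that T by (auto simp: is_mst_def spanning_tree_def)
    moreover have "g \<in> T' \<longleftrightarrow> g \<in> T" if "g \<in> edges G" for g
      using mst_iff[OF \<open>is_mst G w T'\<close> inj that] mst_iff[OF T inj that] by simp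
    ultimately show ?thesis
      by (meson subsetD subsetI subset_antisym)
  qed
  have "MST G w = T"
    unfolding MST_def using T unique by (rule the_equality)
  then show ?thesis
    using mst_iff[OF T inj e] by simp
qed

end

subsection \<open>Order events of i.i.d. weights\<close>

text \<open>Both weightings order \<open>R\<close> like an initial segment of the naturals. Ranking
  by \<open>x\<close> and then inverting the ranking by \<open>y\<close> gives the
  permutation.\<close>

lemma exists_order_permutation:
  fixes x y :: "'e \<Rightarrow> real"
  assumes fin: "finite R" and x: "inj_on x R" and y: "inj_on y R"
  shows "\<exists>\<tau>. \<tau> permutes R \<and> (\<forall>g\<in>R. \<forall>h\<in>R. x g < x h \<longleftrightarrow> y (\<tau> g) < y (\<tau> h))"
proof -
  \<comment> \<open>Strictly smaller elements are counted, so ranks start at 0 and fill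
    \<open>{..<card R}\<close>.\<close>
  define rank where "rank z g = card {h \<in> R. z h < z g}" for z :: "'e \<Rightarrow> real" and g
  have mono: "rank z g < rank z h" if "g \<in> R" "z g < z h" for z g h
    unfolding rank_def using that fin by (intro psubset_card_mono) auto
  have rank_iff: "rank z g < rank z h \<longleftrightarrow> z g < z h" if "inj_on z R" "g \<in> R" "h \<in> R" for z g h
    using mono[of g z h] mono[of h z g] that
    by (metis inj_onD less_irrefl not_less_iff_gr_or_eq)
  have bij: "bij_betw (rank z) R {..<card R}" if z: "inj_on z R" for z
  proof -
    have inj: "inj_on (rank z) R"
      using rank_iff[OF z] z
      by (metis inj_on_def less_irrefl linorder_neqE_linordered_idom)
    have "rank z g < card R" if "g \<in> R" for g
      unfolding rank_def using that fin by (intro psubset_card_mono) auto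
    then have "rank z ` R \<subseteq> {..<card R}"
      by auto
    moreover have "card (rank z ` R) = card {..<card R}"
      using inj by (simp add: card_image)
    ultimately show ?thesis
      using inj by (simp add: bij_betw_def card_subset_eq)
  qed
  define \<tau> where "\<tau> g = (if g \<in> R then inv_into R (rank y) (rank x g) else g)" for g
  have "bij_betw (inv_into R (rank y) \<circ> rank x) R R"
    using bij[OF x] bij_betw_inv_into[OF bij[OF y]] by (rule bij_betw_trans)
  then have \<tau>R: "bij_betw \<tau> R R"
    by (rule bij_betw_cong[THEN iffD1, rotated]) (simp add: \<tau>_def)
  then have "\<tau> permutes R"
    by (rule bij_imp_permutes) (simp add: \<tau>_def)
  moreover have "rank y (\<tau> g) = rank x g" if "g \<in> R" for g
  proof -
    have "rank x g \<in> rank y ` R"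
      using that bij[OF x] bij[OF y] by (auto simp: bij_betw_def)
    then show ?thesis
      using that by (simp add: \<tau>_def f_inv_into_f)
  qed
  then have "x g < x h \<longleftrightarrow> y (\<tau> g) < y (\<tau> h)" if "g \<in> R" "h \<in> R" for g h
    using that rank_iff[OF x, of g h] rank_iff[OF y, of "\<tau> g" "\<tau> h"] \<tau>R
    by (metis bij_betwE)
  ultimately show ?thesis
    by blast
qed

text \<open>Some \<open>y \<circ> \<tau>\<close> orders \<open>R\<close> as \<open>x\<close> does,
  and composing with \<open>\<tau>\<close> on the left only reorders the sum over all
  permutations.\<close>

lemma sum_order_permutations_cong:
  fixes x y :: "'e \<Rightarrow> real"
  assumes fin: "finite R" and x: "inj_on x R" and y: "inj_on y R"
    and Q: "\<And>x y. (\<And>g h. g \<in> R \<Longrightarrow> h \<in> R \<Longrightarrow> x g < x h \<longleftrightarrow> y g < y h) \<Longrightarrow> Q x \<longleftrightarrow> Q y"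
  shows "(\<Sum>p | p permutes R. of_bool (Q (x \<circ> p))) = (\<Sum>p | p permutes R. of_bool (Q (y \<circ> p)) :: real)"
proof -
  obtain \<tau> where \<tau>: "\<tau> permutes R" "\<And>g h. g \<in> R \<Longrightarrow> h \<in> R \<Longrightarrow> x g < x h \<longleftrightarrow> y (\<tau> g) < y (\<tau> h)"
    using exists_order_permutation[OF fin x y] by blast
  have "Q (x \<circ> p) \<longleftrightarrow> Q (y \<circ> (\<tau> \<circ> p))" if "p permutes R" for p
    using \<tau>(2) permutes_in_image[OF that] by (intro Q) simp
  then have "(\<Sum>p | p permutes R. of_bool (Q (x \<circ> p))) =
      (\<Sum>p | p permutes R. of_bool (Q (y \<circ> (\<tau> \<circ> p))) :: real)"
    by (intro sum.cong) auto
  then show ?thesis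
    using setum_permutations_compose_left[OF \<tau>(1), of "\<lambda>p. of_bool (Q (y \<circ> p)) :: real"] by simp
qed

text \<open>The random set takes finitely many values, each on a measurable event, so
  \<open>\<Phi>\<close> may be arbitrary.\<close>

lemma pred_finite_Collect:
  assumes fin: "finite A" and P: "\<And>a. a \<in> A \<Longrightarrow> Measurable.pred M (P a)"
  shows "Measurable.pred M (\<lambda>x. \<Phi> {a \<in> A. P a x})"
proof -
  have "Measurable.pred M (\<lambda>x. \<exists>S\<in>Pow A. \<Phi> S \<and> (\<forall>a\<in>A. P a x \<longleftrightarrow> a \<in> S))"
    using fin P by (intro pred_intros_finite pred_intros_logic) auto
  moreover have "\<Phi> {a \<in> A. P a x} \<longleftrightarrow> (\<exists>S\<in>Pow A. \<Phi> S \<and> (\<forall>a\<in>A. P a x \<longleftrightarrow> a \<in> S))" for x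
  proof -
    have "{a \<in> A. P a x} = S" if "S \<in> Pow A" "\<forall>a\<in>A. P a x \<longleftrightarrow> a \<in> S" for S
      using that by auto
    then show ?thesis
      by auto
  qed
  ultimately show ?thesis
    by simp
qed

section \<open>Weights as the coordinates of a product space\<close>

locale iid_weights =
  fixes E :: "'e set" and \<mu> :: "real measure"
  assumes finite_E: "finite E"
    and prob_space_\<mu>: "prob_space \<mu>"
    and sets_\<mu>: "sets \<mu> = sets borel"
    and atomless: "measure \<mu> {x} = 0"
begin

definition W :: "('e \<Rightarrow> real) measure" where
  "W = (\<Pi>\<^sub>M g\<in>E. \<mu>)"

sublocale prob_space W
  unfolding W_def by (intro prob_space_PiM prob_space_\<mu>)

lemma measurable_coordinate [measurable]: "g \<in> E \<Longrightarrow> (\<lambda>x. x g) \<in> borel_measurable W"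
  unfolding W_def
  using measurable_component_singleton[of g E "\<lambda>_. \<mu>"] measurable_cong_sets[OF refl sets_\<mu>] by blast

lemma pred_coordinates_less [measurable]:
  "g \<in> E \<Longrightarrow> h \<in> E \<Longrightarrow> Measurable.pred W (\<lambda>x. x g < x h)"
  by measurable

lemma pred_below [measurable]:
  assumes "R \<subseteq> E" and "f \<in> E"
  shows "Measurable.pred W (\<lambda>x. \<Phi> {g \<in> R. x g < x f})"
  using assms finite_subset[OF _ finite_E] by (intro pred_finite_Collect) auto

text \<open>The joint law of two coordinates is a product measure. By Fubini its diagonal is null,
  as each section is a single point and \<open>\<mu>\<close> has no atoms.\<close>

lemma AE_coordinates_neq:
  assumes "g \<in> E" "h \<in> E" "g \<noteq> h"
  shows "AE x in W. x g \<noteq> x h"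
proof -
  interpret \<mu>: prob_space \<mu>
    by (rule prob_space_\<mu>)
  interpret pair: pair_prob_space \<mu> \<mu> ..
  have dist: "distr W \<mu> (\<lambda>x. x i) = \<mu>" if "i \<in> E" for i
    unfolding W_def using distr_PiM_component[of E "\<lambda>_. \<mu>" i] that prob_space_\<mu> by simp
  have rv: "(\<lambda>x. x i) \<in> measurable W \<mu>" if "i \<in> E" for i
    using that unfolding W_def by simp
  \<comment> \<open>Restriction to \<open>E\<close> is the identity on the space of
    \<open>W\<close>, so the joint law of the coordinates is the product of their marginals, which
    is the criterion for independence.\<close>
  have "distr W (\<Pi>\<^sub>M i\<in>E. \<mu>) (\<lambda>x. \<lambda>i\<in>E. x i) = distr W W (\<lambda>x. x)"
    by (rule distr_cong) (auto simp: W_def space_PiM)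
  also have "\<dots> = (\<Pi>\<^sub>M i\<in>E. distr W \<mu> (\<lambda>x. x i))"
    using dist by (simp add: distr_id W_def cong: PiM_cong)
  finally have ind: "indep_vars (\<lambda>_. \<mu>) (\<lambda>i x. x i) E"
    using assms rv by (subst indep_vars_iff_distr_eq_PiM') auto
  have "indep_var \<mu> ((\<lambda>y. y g) \<circ> (\<lambda>x. restrict (\<lambda>i. x i) {g})) \<mu> ((\<lambda>y. y h) \<circ> (\<lambda>x. restrict (\<lambda>i. x i) {h}))"
    using assms by (intro indep_var_compose[OF indep_var_restrict[OF ind]]) auto
  then have "indep_var \<mu> (\<lambda>x. x g) \<mu> (\<lambda>x. x h)"
    by (simp add: o_def)
  then have pd: "distr W (\<mu> \<Otimes>\<^sub>M \<mu>) (\<lambda>x. (x g, x h)) = \<mu> \<Otimes>\<^sub>M \<mu>"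
    using assms by (simp add: indep_var_distribution_eq dist)
  have "sets (\<mu> \<Otimes>\<^sub>M \<mu>) = sets (borel \<Otimes>\<^sub>M borel)"
    by (intro sets_pair_measure_cong sets_\<mu>)
  then have meas: "Measurable.pred (\<mu> \<Otimes>\<^sub>M \<mu>) (\<lambda>z. fst z \<noteq> snd z)"
    by (subst measurable_cong_sets[OF _ refl]) auto
  have null: "{a} \<in> null_sets \<mu>" for a
    using atomless sets_\<mu> by (auto simp: null_sets_def \<mu>.emeasure_eq_measure)
  have "AE b in \<mu>. a \<noteq> b" for a
    using AE_not_in[OF null[of a]] by (rule AE_mp) auto
  then have "AE z in \<mu> \<Otimes>\<^sub>M \<mu>. fst z \<noteq> snd z"
    using meas by (intro pair.AE_pair_measure) (auto simp: pred_def)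
  then have "AE z in distr W (\<mu> \<Otimes>\<^sub>M \<mu>) (\<lambda>x. (x g, x h)). fst z \<noteq> snd z"
    unfolding pd .
  with rv assms have "AE x in W. fst (x g, x h) \<noteq> snd (x g, x h)"
    by (intro AE_distrD[where M = W and M' = "\<mu> \<Otimes>\<^sub>M \<mu>" and P = "\<lambda>z. fst z \<noteq> snd z"] measurable_Pair)
  then show ?thesis
    by simp
qed

lemma AE_inj_on: "AE x in W. inj_on x E"
proof -
  have "AE x in W. \<forall>g\<in>E. \<forall>h\<in>E. g \<noteq> h \<longrightarrow> x g \<noteq> x h"
    using AE_coordinates_neq finite_E by (intro AE_finite_allI) auto
  then show ?thesis
    by (rule AE_mp) (auto simp: inj_on_def)
qed

text \<open>The factors of the product are identical, so relabelling the coordinates preserves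
  it.\<close>

lemma measure_permute:
  assumes p: "p permutes R" and R: "R \<subseteq> E" and Q [measurable]: "Measurable.pred W Q"
  shows "Measurable.pred W (\<lambda>x. Q (x \<circ> p))"
    and "measure W {x \<in> space W. Q (x \<circ> p)} = measure W {x \<in> space W. Q x}"
proof -
  have pE: "p permutes E"
    using p R by (rule permutes_subset)
  \<comment> \<open>Points of the space are \<open>undefined\<close> outside \<open>E\<close>, where
    \<open>p\<close> is the identity, so the restriction changes nothing.\<close>
  have eq: "(\<lambda>n\<in>E. x (p n)) = x \<circ> p" if "x \<in> space W" for x
    using that permutes_not_in[OF pE]
    by (fastforce simp: W_def space_PiM PiE_def extensional_def fun_eq_iff)
  have meas: "(\<lambda>x. \<lambda>n\<in>E. x (p n)) \<in> measurable W W"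
    unfolding W_def using permutes_in_image[OF pE] by (intro measurable_restrict) auto
  have "Measurable.pred W (\<lambda>x. Q (\<lambda>n\<in>E. x (p n)))"
    using measurable_compose[OF meas Q] .
  then show "Measurable.pred W (\<lambda>x. Q (x \<circ> p))"
    by (subst measurable_cong[where g = "\<lambda>x. Q (\<lambda>n\<in>E. x (p n))"]) (simp_all add: eq)
  have "distr W W (\<lambda>x. \<lambda>n\<in>E. x (p n)) = W"
    unfolding W_def using permutes_in_image[OF pE] permutes_inj_on[OF pE] prob_space_\<mu>
    by (intro distr_PiM_reindex) auto
  then have "measure W {x \<in> space W. Q x} =
      measure (distr W W (\<lambda>x. \<lambda>n\<in>E. x (p n))) {x \<in> space W. Q x}"
    by simp
  also have "\<dots> = measure W ((\<lambda>x. \<lambda>n\<in>E. x (p n)) -` {x \<in> space W. Q x} \<inter> space W)"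
    by (rule measure_distr[OF meas]) measurable
  also have "(\<lambda>x. \<lambda>n\<in>E. x (p n)) -` {x \<in> space W. Q x} \<inter> space W = {x \<in> space W. Q (x \<circ> p)}"
    using measurable_space[OF meas] by (auto simp: eq)
  finally show "measure W {x \<in> space W. Q (x \<circ> p)} = measure W {x \<in> space W. Q x}"
    by simp
qed

lemma measure_Collect_eq_integral:
  "measure W {x \<in> space W. P x} = (\<integral>x. of_bool (P x) \<partial>W :: real)"
proof -
  have "(\<integral>x. of_bool (P x) \<partial>W) = (\<integral>x. indicator {x \<in> space W. P x} x \<partial>W :: real)"
    by (rule Bochner_Integration.integral_cong) (auto simp: indicator_def)
  moreover have "{x \<in> space W. P x} \<inter> space W = {x \<in> space W. P x}"
    by auto
  ultimately show ?thesis
    by simp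
qed

text \<open>Averaging over the permutations of \<open>R\<close> replaces the order event \<open>Q\<close> by the almost surely
  constant number of permutations that satisfy it.\<close>

lemma measure_invariant_order_event:
  assumes R: "R \<subseteq> E"
    and P [measurable]: "Measurable.pred W P" and Q [measurable]: "Measurable.pred W Q"
    and P_inv: "\<And>x p. p permutes R \<Longrightarrow> P (x \<circ> p) \<longleftrightarrow> P x"
    and Q_order: "\<And>x y. (\<And>g h. g \<in> R \<Longrightarrow> h \<in> R \<Longrightarrow> x g < x h \<longleftrightarrow> y g < y h) \<Longrightarrow> Q x \<longleftrightarrow> Q y"
  shows "measure W {x \<in> space W. P x \<and> Q x} =
    measure W {x \<in> space W. P x} * measure W {x \<in> space W. Q x}"
proof -
  let ?K = "{p. p permutes R}"
  have finR: "finite R"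
    using R finite_E by (rule finite_subset)
  then have K: "finite ?K" "card ?K > 0"
    by (simp_all add: finite_permutations card_permutations)
  \<comment> \<open>Any injective reference weighting will do: \<open>c\<close> counts the
    permutations of it that satisfy \<open>Q\<close>, and this count is the same for every weighting
    injective on \<open>R\<close>.\<close>
  obtain z :: "'e \<Rightarrow> nat" where "inj_on z R"
    using finite_imp_inj_to_nat_seg[OF finR] by blast
  then have z: "inj_on (real \<circ> z) R"
    by (auto simp: inj_on_def)
  define c :: real where "c = (\<Sum>p\<in>?K. of_bool (Q ((real \<circ> z) \<circ> p)))"
  \<comment> \<open>Stated for general \<open>P'\<close> so that it applies both to \<open>P\<close>
    and to the sure event; the latter identifies \<open>c\<close> as \<open>card ?K\<close> times
    the probability of \<open>Q\<close>.\<close>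
  have main: "card ?K * measure W {x \<in> space W. P' x \<and> Q x} = c * measure W {x \<in> space W. P' x}"
    if P' [measurable]: "Measurable.pred W P'"
      and P'_inv: "\<And>x p. p permutes R \<Longrightarrow> P' (x \<circ> p) \<longleftrightarrow> P' x" for P'
  proof -
    have meas: "Measurable.pred W (\<lambda>x. Q (x \<circ> p))" if "p \<in> ?K" for p
      using that R Q measure_permute(1) by blast
    have int: "integrable W (\<lambda>x. of_bool (P' x) * of_bool (Q (x \<circ> p)) :: real)" if "p \<in> ?K" for p
      using meas[OF that]
      by (intro integrable_const_bound[of _ 1]) (auto simp flip: of_bool_conj)
    \<comment> \<open>Relabelling by \<open>p\<close> leaves \<open>P'\<close> unchanged and turns
      \<open>Q x\<close> into \<open>Q (x \<circ> p)\<close>.\<close>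
    have eq: "measure W {x \<in> space W. P' x \<and> Q x} = (\<integral>x. of_bool (P' x) * of_bool (Q (x \<circ> p)) \<partial>W)"
      if p: "p \<in> ?K" for p
      using measure_permute(2)[of p R "\<lambda>x. P' x \<and> Q x"] p R P'_inv
      by (simp add: measure_Collect_eq_integral of_bool_conj)
    have "card ?K * measure W {x \<in> space W. P' x \<and> Q x} =
        (\<Sum>p\<in>?K. measure W {x \<in> space W. P' x \<and> Q x})"
      by simp
    also have "\<dots> = (\<Sum>p\<in>?K. \<integral>x. of_bool (P' x) * of_bool (Q (x \<circ> p)) \<partial>W)"
      using eq by (rule sum.cong[OF refl])
    also have "\<dots> = (\<integral>x. (\<Sum>p\<in>?K. of_bool (P' x) * of_bool (Q (x \<circ> p))) \<partial>W)"
      using int by (subst Bochner_Integration.integral_sum) auto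
    also have "\<dots> = (\<integral>x. c * of_bool (P' x) \<partial>W)"
    proof (rule integral_cong_AE)
      show "AE x in W. (\<Sum>p\<in>?K. of_bool (P' x) * of_bool (Q (x \<circ> p))) = c * of_bool (P' x)"
        using AE_inj_on
      proof (rule AE_mp, intro AE_I2 impI)
        fix x :: "'e \<Rightarrow> real"
        assume "inj_on x E"
        then have "inj_on x R"
          using R by (rule inj_on_subset)
        then have "(\<Sum>p\<in>?K. of_bool (Q (x \<circ> p))) = c"
          unfolding c_def by (intro sum_order_permutations_cong finR z Q_order) auto
        then show "(\<Sum>p\<in>?K. of_bool (P' x) * of_bool (Q (x \<circ> p))) = c * of_bool (P' x)"
          by (simp flip: sum_distrib_left)
      qed
    qed (use int in auto)
    also have "\<dots> = c * measure W {x \<in> space W. P' x}"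
      by (simp add: measure_Collect_eq_integral)
    finally show ?thesis .
  qed
  have "card ?K * measure W {x \<in> space W. Q x} = c"
    using main[of "\<lambda>_. True"] by (simp add: prob_space)
  then have "card ?K * measure W {x \<in> space W. P x \<and> Q x} =
      card ?K * (measure W {x \<in> space W. P x} * measure W {x \<in> space W. Q x})"
    using main[OF P P_inv] by simp
  then show ?thesis
    using K permutes_id[of R] by auto
qed

section \<open>The correlation inequality on the product space\<close>

text \<open>The graph is abstracted to a predicate \<open>sep\<close> that passes to smaller edge
  sets. The event is decomposed by the set \<open>L\<close> of edges lighter than
  \<open>e\<close>.\<close>

lemma measure_joint_less_le:
  fixes sep :: "'e set \<Rightarrow> 'e \<Rightarrow> bool"
  assumes ef: "e \<in> E" "f \<in> E" "e \<noteq> f"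
    and antimono: "\<And>S S' g. sep S g \<Longrightarrow> S' \<subseteq> S \<Longrightarrow> sep S' g"
  shows "measure W {x \<in> space W. sep {g \<in> E. x g < x e} e \<and> sep {g \<in> E. x g < x f} f \<and> x e < x f}
    \<le> measure W {x \<in> space W. sep {g \<in> E. x g < x e} e} *
      measure W {x \<in> space W. sep {g \<in> E. x g < x f} f}"
proof -
  note [measurable] = ef(1,2)
  \<comment> \<open>The possible values of \<open>L\<close> when \<open>e\<close> is separated and
    lighter than \<open>f\<close>.\<close>
  define \<L> where "\<L> = {L \<in> Pow (E - {e, f}). sep L e}"
  define P where "P L x \<longleftrightarrow> (\<forall>g\<in>L. x g < x e) \<and> (\<forall>g\<in>E - L - {e}. x e < x g)"
    for L and x :: "'e \<Rightarrow> real"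
  \<comment> \<open>When \<open>P L x\<close> holds, this is separation of \<open>f\<close> by the
    lighter edges. Written this way it depends only on the order within \<open>E - L - {e}\<close>,
    while permuting that set preserves \<open>P L\<close>; hence the two are independent.\<close>
  define Q where "Q L x \<longleftrightarrow> sep (L \<union> {e} \<union> {g \<in> E - L - {e}. x g < x f}) f"
    for L and x :: "'e \<Rightarrow> real"
  have fin: "finite \<L>"
    using finite_E by (simp add: \<L>_def)
  have finL: "finite L" "L \<subseteq> E" "e \<notin> L" "f \<notin> L" "sep L e" if "L \<in> \<L>" for L
    using that finite_E by (auto simp: \<L>_def intro: finite_subset)
  have P_meas: "Measurable.pred W (P L)" if "L \<in> \<L>" for L
    unfolding P_def using finL[OF that] finite_E ef
    by (intro pred_intros_logic pred_intros_finite pred_coordinates_less) auto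
  have Q_meas: "Measurable.pred W (Q L)" for L
    unfolding Q_def using ef by (intro pred_below) auto
  have below: "{g \<in> E. x g < x e} = L" if "L \<in> \<L>" "P L x" for L x
  proof (rule set_eqI)
    fix g
    show "g \<in> {g \<in> E. x g < x e} \<longleftrightarrow> g \<in> L"
      using that(2) finL(2)[OF that(1)] unfolding P_def
      by (cases "g \<in> L"; cases "g = e") (auto dest: less_asym)
  qed
  have indep: "measure W {x \<in> space W. P L x \<and> Q L x} =
      measure W {x \<in> space W. P L x} * measure W {x \<in> space W. Q L x}" if L: "L \<in> \<L>" for L
  proof (rule measure_invariant_order_event[where R = "E - L - {e}"])
    fix x :: "'e \<Rightarrow> real" and p
    assume p: "p permutes E - L - {e}"
    have fix_L: "p g = g" if "g \<in> L" for g
      using permutes_not_in[OF p] that by simp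
    have fix_e: "p e = e"
      using permutes_not_in[OF p] by simp
    have "(\<forall>g\<in>E - L - {e}. x e < x (p g)) \<longleftrightarrow> (\<forall>g\<in>p ` (E - L - {e}). x e < x g)"
      by blast
    then show "P L (x \<circ> p) \<longleftrightarrow> P L x"
      unfolding P_def permutes_image[OF p] by (simp add: fix_L fix_e)
  next
    fix x y :: "'e \<Rightarrow> real"
    assume xy: "\<And>g h. g \<in> E - L - {e} \<Longrightarrow> h \<in> E - L - {e} \<Longrightarrow> x g < x h \<longleftrightarrow> y g < y h"
    have "f \<in> E - L - {e}"
      using finL[OF L] ef by simp
    then have "{g \<in> E - L - {e}. x g < x f} = {g \<in> E - L - {e}. y g < y f}"
      using xy by blast
    then show "Q L x \<longleftrightarrow> Q L y"
      by (simp add: Q_def)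
  qed (use P_meas[OF L] Q_meas in auto)
  \<comment> \<open>Unconditionally, the set in \<open>Q\<close> contains all edges lighter than
    \<open>f\<close>, so \<open>Q\<close> is the stronger condition.\<close>
  have Q_le: "measure W {x \<in> space W. Q L x} \<le> measure W {x \<in> space W. sep {g \<in> E. x g < x f} f}" for L
  proof (rule finite_measure_mono)
    show "{x \<in> space W. Q L x} \<subseteq> {x \<in> space W. sep {g \<in> E. x g < x f} f}"
      unfolding Q_def by (auto elim!: antimono)
    show "{x \<in> space W. sep {g \<in> E. x g < x f} f} \<in> sets W"
      using pred_below[of E f "\<lambda>S. sep S f"] ef by (simp add: pred_def)
  qed
  have "measure W {x \<in> space W. sep {g \<in> E. x g < x e} e \<and> sep {g \<in> E. x g < x f} f \<and> x e < x f}
      \<le> measure W (\<Union>L\<in>\<L>. {x \<in> space W. P L x \<and> Q L x})"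
  proof (rule finite_measure_mono_AE)
    show "AE x in W. x \<in> {x \<in> space W. sep {g \<in> E. x g < x e} e \<and> sep {g \<in> E. x g < x f} f \<and> x e < x f}
        \<longrightarrow> x \<in> (\<Union>L\<in>\<L>. {x \<in> space W. P L x \<and> Q L x})"
      using AE_inj_on
    proof (rule AE_mp, intro AE_I2 impI)
      fix x
      assume inj: "inj_on x E" and
        x: "x \<in> {x \<in> space W. sep {g \<in> E. x g < x e} e \<and> sep {g \<in> E. x g < x f} f \<and> x e < x f}"
      define L where "L = {g \<in> E. x g < x e}"
      have "L \<in> \<L>"
        using x by (auto simp: L_def \<L>_def)
      \<comment> \<open>Edges outside \<open>L\<close> are not lighter than \<open>e\<close>;
        injectivity of \<open>x\<close>, which holds almost surely, makes them strictly
        heavier.\<close>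
      moreover have "x e < x g" if "g \<in> E - L - {e}" for g
        using inj that ef(1) by (force simp: L_def inj_on_def not_less le_less)
      then have "P L x"
        by (auto simp: P_def L_def)
      moreover have "L \<union> {e} \<union> {g \<in> E - L - {e}. x g < x f} = {g \<in> E. x g < x f}"
        using x ef by (auto simp: L_def)
      then have "Q L x"
        using x by (simp add: Q_def)
      ultimately show "x \<in> (\<Union>L\<in>\<L>. {x \<in> space W. P L x \<and> Q L x})"
        using x by blast
    qed
    show "(\<Union>L\<in>\<L>. {x \<in> space W. P L x \<and> Q L x}) \<in> sets W"
      using fin P_meas Q_meas by (intro sets.finite_UN) auto
  qed
  also have "\<dots> \<le> (\<Sum>L\<in>\<L>. measure W {x \<in> space W. P L x \<and> Q L x})"
    using fin P_meas Q_meas by (intro finite_measure_subadditive_finite) auto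
  also have "\<dots> \<le> (\<Sum>L\<in>\<L>. measure W {x \<in> space W. P L x} *
      measure W {x \<in> space W. sep {g \<in> E. x g < x f} f})"
    using Q_le by (intro sum_mono) (simp add: indep mult_left_mono)
  also have "\<dots> = measure W (\<Union>L\<in>\<L>. {x \<in> space W. P L x}) *
      measure W {x \<in> space W. sep {g \<in> E. x g < x f} f}"
  proof -
    \<comment> \<open>\<open>P L x\<close> determines \<open>L\<close> as the set of edges lighter
      than \<open>e\<close>, so the sum collapses to the probability of a union.\<close>
    have "disjoint_family_on (\<lambda>L. {x \<in> space W. P L x}) \<L>"
      using below by (auto simp: disjoint_family_on_def)
    then have "measure W (\<Union>L\<in>\<L>. {x \<in> space W. P L x}) = (\<Sum>L\<in>\<L>. measure W {x \<in> space W. P L x})"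
      using fin P_meas by (intro finite_measure_finite_Union) (auto simp: pred_def)
    then show ?thesis
      by (simp add: sum_distrib_right)
  qed
  \<comment> \<open>Only an inclusion: \<open>f\<close> is never in \<open>L\<close>, so the union
    covers only weights with \<open>e\<close> lighter than \<open>f\<close>.\<close>
  also have "\<dots> \<le> measure W {x \<in> space W. sep {g \<in> E. x g < x e} e} *
      measure W {x \<in> space W. sep {g \<in> E. x g < x f} f}"
  proof (intro mult_right_mono finite_measure_mono)
    show "(\<Union>L\<in>\<L>. {x \<in> space W. P L x}) \<subseteq> {x \<in> space W. sep {g \<in> E. x g < x e} e}"
      using below finL(5) by auto
    show "{x \<in> space W. sep {g \<in> E. x g < x e} e} \<in> sets W"
      using pred_below[of E e "\<lambda>S. sep S e"] ef by (simp add: pred_def)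
  qed simp
  finally show ?thesis .
qed

text \<open>Ties between \<open>e\<close> and \<open>f\<close> are null, and the two strict orders
  contribute the same bound with the roles exchanged, whence the factor 2.\<close>

lemma measure_joint_le:
  fixes sep :: "'e set \<Rightarrow> 'e \<Rightarrow> bool"
  assumes ef: "e \<in> E" "f \<in> E" "e \<noteq> f"
    and antimono: "\<And>S S' g. sep S g \<Longrightarrow> S' \<subseteq> S \<Longrightarrow> sep S' g"
  shows "measure W {x \<in> space W. sep {g \<in> E. x g < x e} e \<and> sep {g \<in> E. x g < x f} f}
    \<le> 2 * measure W {x \<in> space W. sep {g \<in> E. x g < x e} e} *
      measure W {x \<in> space W. sep {g \<in> E. x g < x f} f}"
proof -
  define I where "I g x \<longleftrightarrow> sep {h \<in> E. x h < x g} g" for g and x :: "'e \<Rightarrow> real"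
  have [measurable]: "Measurable.pred W (I g)" if "g \<in> E" for g
    unfolding I_def using that by (intro pred_below) auto
  note [measurable] = ef(1,2)
  have "AE x in W. x e \<noteq> x f"
    using ef by (rule AE_coordinates_neq)
  then have "measure W {x \<in> space W. I e x \<and> I f x} \<le>
      measure W ({x \<in> space W. I e x \<and> I f x \<and> x e < x f} \<union> {x \<in> space W. I f x \<and> I e x \<and> x f < x e})"
    by (intro finite_measure_mono_AE) (auto elim!: AE_mp)
  also have "\<dots> \<le> measure W {x \<in> space W. I e x \<and> I f x \<and> x e < x f} +
      measure W {x \<in> space W. I f x \<and> I e x \<and> x f < x e}"
    by (rule measure_Un_le) measurable
  also have "\<dots> \<le> measure W {x \<in> space W. I e x} * measure W {x \<in> space W. I f x} +
      measure W {x \<in> space W. I f x} * measure W {x \<in> space W. I e x}"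
    unfolding I_def using ef antimono by (intro add_mono measure_joint_less_le) blast+
  finally show ?thesis
    by (simp add: I_def)
qed

end

section \<open>Transfer from the product space to the given weights\<close>

theorem theoremA:
  fixes G :: "('v, 'e) multigraph"
    and M :: "'a measure"
    and w :: "'e \<Rightarrow> 'a \<Rightarrow> real"
    and \<mu> :: "real measure"
    and e f :: 'e
  assumes "finite_multigraph G"
    and "connected_graph G"
    and "prob_space M"
    and "prob_space.indep_vars M (\<lambda>_. borel) w (edges G)"
    and "\<And>g. g \<in> edges G \<Longrightarrow> distr M borel (w g) = \<mu>"
    and "\<And>x. measure \<mu> {x} = 0"
    and "e \<in> edges G" and "f \<in> edges G" and "e \<noteq> f"
  shows "measure M {\<omega> \<in> space M. e \<in> MST G (\<lambda>g. w g \<omega>) \<and> f \<in> MST G (\<lambda>g. w g \<omega>)}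
       \<le> 8 * measure M {\<omega> \<in> space M. e \<in> MST G (\<lambda>g. w g \<omega>)}
           * measure M {\<omega> \<in> space M. f \<in> MST G (\<lambda>g. w g \<omega>)}"
proof -
  interpret connected_multigraph G
    using assms(1,2) by (simp add: connected_multigraph_def connected_multigraph_axioms_def)
  interpret M: prob_space M
    by fact
  let ?E = "edges G"
  have rv: "w g \<in> borel_measurable M" if "g \<in> ?E" for g
    using assms(4) that by (auto simp: M.indep_vars_def)
  interpret iid_weights ?E \<mu>
  proof (rule iid_weights.intro)
    show "finite ?E"
      by (rule finite_edges)
    show "prob_space \<mu>" "sets \<mu> = sets borel"
      using assms(5)[OF assms(7)] M.prob_space_distr[OF rv[OF assms(7)]] by auto
  qed (fact assms(6))
  \<comment> \<open>The restriction to \<open>?E\<close> makes the values points of the product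
    space; independence and the common law then make \<open>W\<close> the law of
    \<open>X\<close>.\<close>
  define X where "X \<omega> = (\<lambda>g\<in>?E. w g \<omega>)" for \<omega>
  have "distr M (\<Pi>\<^sub>M g\<in>?E. borel) X = (\<Pi>\<^sub>M g\<in>?E. distr M borel (w g))"
    using assms(4,7) rv unfolding X_def by (subst (asm) M.indep_vars_iff_distr_eq_PiM') auto
  also have "\<dots> = W"
    unfolding W_def using assms(5) by (intro PiM_cong) auto
  finally have "distr M (\<Pi>\<^sub>M g\<in>?E. borel) X = W" .
  moreover have setsW: "sets W = sets (\<Pi>\<^sub>M g\<in>?E. borel)"
    unfolding W_def by (intro sets_PiM_cong) (auto simp: sets_\<mu>)
  ultimately have distr_X: "distr M W X = W"
    by (metis distr_cong)
  have X: "X \<in> measurable M W"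
    unfolding X_def measurable_cong_sets[OF refl setsW] using rv by (intro measurable_restrict)
  define sep where "sep S g \<longleftrightarrow> \<not> joins G S g" for S g
  have sep_antimono: "sep S' g" if "sep S g" "S' \<subseteq> S" for S S' g
    using that joins_mono unfolding sep_def by metis
  have mem_MST: "AE \<omega> in M. \<forall>g\<in>?E. g \<in> MST G (\<lambda>g. w g \<omega>) \<longleftrightarrow> sep {h \<in> ?E. X \<omega> h < X \<omega> g} g"
  proof -
    have "AE \<omega> in M. inj_on (X \<omega>) ?E"
      using AE_inj_on by (intro AE_distrD[OF X]) (unfold distr_X)
    then show ?thesis
    proof (rule AE_mp, intro AE_I2 impI ballI)
      fix \<omega> g
      assume "inj_on (X \<omega>) ?E" and g: "g \<in> ?E"
      then have "inj_on (\<lambda>g. w g \<omega>) ?E"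
        by (simp add: X_def inj_on_def)
      then have "g \<in> MST G (\<lambda>g. w g \<omega>) \<longleftrightarrow> sep {h \<in> ?E. w h \<omega> < w g \<omega>} g"
        unfolding sep_def by (rule mem_MST_iff) (rule g)
      also have "{h \<in> ?E. w h \<omega> < w g \<omega>} = {h \<in> ?E. X \<omega> h < X \<omega> g}"
        using g by (auto simp: X_def)
      finally show "g \<in> MST G (\<lambda>g. w g \<omega>) \<longleftrightarrow> sep {h \<in> ?E. X \<omega> h < X \<omega> g} g" .
    qed
  qed
  \<comment> \<open>Measurability must also cover weights with ties. It holds there too, as
    \<open>MST\<close> is a function of the set of minimizers, a random subset of the finite set
    \<open>Pow ?E\<close>.\<close>
  have MST_meas: "Measurable.pred M (\<lambda>\<omega>. \<Phi> (MST G (\<lambda>g. w g \<omega>)))" for \<Phi>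
  proof -
    have sum_meas: "(\<lambda>\<omega>. \<Sum>g\<in>T. w g \<omega>) \<in> borel_measurable M" if "T \<subseteq> ?E" for T
      using that rv by (intro borel_measurable_sum) auto
    have "Measurable.pred M (\<lambda>\<omega>. is_mst G (\<lambda>g. w g \<omega>) T)" if "T \<in> Pow ?E" for T
    proof -
      have "Measurable.pred M (\<lambda>\<omega>. spanning_tree G T \<and>
          (\<forall>T'\<in>Collect (spanning_tree G). (\<Sum>g\<in>T. w g \<omega>) \<le> (\<Sum>g\<in>T'. w g \<omega>)))"
      proof (intro pred_intros_logic pred_intros_finite)
        show "finite (Collect (spanning_tree G))"
          by (rule finite_subset[of _ "Pow ?E"]) (auto simp: spanning_tree_def finite_edges)
      next
        fix T' assume "T' \<in> Collect (spanning_tree G)"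
        then have "T' \<subseteq> ?E"
          by (simp add: spanning_tree_def)
        then show "Measurable.pred M (\<lambda>\<omega>. (\<Sum>g\<in>T. w g \<omega>) \<le> (\<Sum>g\<in>T'. w g \<omega>))"
          unfolding pred_def using sum_meas that by (intro borel_measurable_le) auto
      qed simp
      then show ?thesis
        by (simp add: is_mst_def)
    qed
    then have "Measurable.pred M
        (\<lambda>\<omega>. \<Phi> (THE T. T \<in> {T \<in> Pow ?E. is_mst G (\<lambda>g. w g \<omega>) T}))"
      using finite_edges
      by (intro pred_finite_Collect[of "Pow ?E" _ _ "\<lambda>S. \<Phi> (THE T. T \<in> S)"]) auto
    moreover have "MST G x = (THE T. T \<in> {T \<in> Pow ?E. is_mst G x T})" for x
      unfolding MST_def
      by (rule arg_cong[where f = The]) (auto simp: fun_eq_iff is_mst_def spanning_tree_def)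
    ultimately show ?thesis
      by (simp only:)
  qed
  have sep_meas: "Measurable.pred W (\<lambda>x. sep {h \<in> ?E. x h < x g} g)" if "g \<in> ?E" for g
    using that by (intro pred_below) auto
  \<comment> \<open>A general \<open>A\<close> treats the joint event and both single events at
    once, with \<open>A\<close> equal to \<open>{e, f}\<close>, \<open>{e}\<close> and
    \<open>{f}\<close>.\<close>
  have transfer: "measure M {\<omega> \<in> space M. \<forall>g\<in>A. g \<in> MST G (\<lambda>g. w g \<omega>)} =
      measure W {x \<in> space W. \<forall>g\<in>A. sep {h \<in> ?E. x h < x g} g}" if A: "A \<subseteq> ?E" for A
  proof -
    have "finite A"
      using A finite_edges by (rule finite_subset)
    then have B: "Measurable.pred W (\<lambda>x. \<forall>g\<in>A. sep {h \<in> ?E. x h < x g} g)"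
      using A sep_meas by (intro pred_intros_finite) auto
    have "measure M {\<omega> \<in> space M. \<forall>g\<in>A. g \<in> MST G (\<lambda>g. w g \<omega>)} =
        measure M {\<omega> \<in> space M. \<forall>g\<in>A. sep {h \<in> ?E. X \<omega> h < X \<omega> g} g}"
    proof (rule M.finite_measure_eq_AE)
      show "AE \<omega> in M. \<omega> \<in> {\<omega> \<in> space M. \<forall>g\<in>A. g \<in> MST G (\<lambda>g. w g \<omega>)} \<longleftrightarrow>
          \<omega> \<in> {\<omega> \<in> space M. \<forall>g\<in>A. sep {h \<in> ?E. X \<omega> h < X \<omega> g} g}"
        using mem_MST by (rule AE_mp) (use A in \<open>auto intro!: AE_I2\<close>)
      show "{\<omega> \<in> space M. \<forall>g\<in>A. g \<in> MST G (\<lambda>g. w g \<omega>)} \<in> sets M"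
        using MST_meas[of "\<lambda>T. \<forall>g\<in>A. g \<in> T"] by (simp add: pred_def)
      show "{\<omega> \<in> space M. \<forall>g\<in>A. sep {h \<in> ?E. X \<omega> h < X \<omega> g} g} \<in> sets M"
        using measurable_compose[OF X B] by (simp add: pred_def)
    qed
    also have "\<dots> = measure M (X -` {x \<in> space W. \<forall>g\<in>A. sep {h \<in> ?E. x h < x g} g} \<inter> space M)"
      using measurable_space[OF X] by (intro arg_cong[where f = "measure M"]) auto
    also have "\<dots> = measure (distr M W X) {x \<in> space W. \<forall>g\<in>A. sep {h \<in> ?E. x h < x g} g}"
      using B by (intro measure_distr[OF X, symmetric]) (simp add: pred_def)
    finally show ?thesis
      by (simp add: distr_X)
  qed
  have "measure M {\<omega> \<in> space M. e \<in> MST G (\<lambda>g. w g \<omega>) \<and> f \<in> MST G (\<lambda>g. w g \<omega>)}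
      \<le> 2 * measure M {\<omega> \<in> space M. e \<in> MST G (\<lambda>g. w g \<omega>)}
          * measure M {\<omega> \<in> space M. f \<in> MST G (\<lambda>g. w g \<omega>)}"
    using measure_joint_le[OF assms(7,8,9) sep_antimono]
      transfer[of "{e, f}"] transfer[of "{e}"] transfer[of "{f}"] assms(7,8) by simp
  also have "\<dots> \<le> 8 * measure M {\<omega> \<in> space M. e \<in> MST G (\<lambda>g. w g \<omega>)}
      * measure M {\<omega> \<in> space M. f \<in> MST G (\<lambda>g. w g \<omega>)}"
    by (intro mult_right_mono) auto
  finally show ?thesis .
qed

end
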